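(* For all non-negative integers $m$ and $n$, the imaginary parts of the complex roots of the box polynomial $B_{m,n}(x)$ are bounded above by $mn/\pi$ and below by $-mn/\pi$; that is, every root $z\in\mathbb{C}$ of $B_{m,n}$ satisfies $-mn/\pi\le \operatorname{Im}(z)\le mn/\pi$.
   Context: For non-negative integers $m,n$, the box polynomial is $$B_{m,n}(x)=\sum_{\lambda\subseteq m\times n}\ \prod_{i=1}^{m}(x+\lambda_i),$$ where the sum is over all integer sequences (partitions) $\lambda=(n\ge\lambda_1\ge\lambda_2\ge\cdots\ge\lambda_m\ge 0)$, i.e. partitions with $m$ non-negative parts, each at most $n$ (an empty product is $1$). *)

theory Defs
  imports Complex_Main "HOL-Computational_Algebra.Polynomial"
begin

text \<open>
  A partition \<open>(\<lambda>\<^sub>1, \<dots>, \<lambda>\<^sub>m)\<close> contained in the \<open>m \<times> n\<close> box is a weakly decreasing list of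
  length \<open>m\<close>, so zero parts are kept; \<open>\<lambda>\<^sub>i\<close> is the list entry with index \<open>i - 1\<close>.
\<close>

definition box_partitions :: "nat \<Rightarrow> nat \<Rightarrow> nat list set" where
  "box_partitions m n = {l. length l = m \<and> sorted_wrt (\<ge>) l \<and> (\<forall>k\<in>set l. k \<le> n)}"

lemma finite_box_partitions: "finite (box_partitions m n)"
  by (rule finite_subset[OF _ finite_lists_length_eq[of "{..n}" m]])
     (auto simp: box_partitions_def)

definition box_poly :: "nat \<Rightarrow> nat \<Rightarrow> 'a :: comm_semiring_1 poly" where
  "box_poly m n = (\<Sum>l\<in>box_partitions m n. \<Prod>i<m. [:of_nat (l ! i), 1:])"

lemma poly_box_poly:
  "poly (box_poly m n) x = (\<Sum>l\<in>box_partitions m n. \<Prod>i<m. (x + of_nat (l ! i)))"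
  by (simp add: box_poly_def poly_sum poly_prod add.commute)

end

theory Submission
  imports Defs
begin

text \<open>
  Suppose \<open>\<bar>Im z\<bar> > m n / \<pi>\<close>. Seen from the origin, the points \<open>z + k\<close> with \<open>0 \<le> k \<le> n\<close> lie in a
  sector of angle at most \<open>n / \<bar>Im z\<bar> < \<pi> / m\<close>, because the segment from \<open>z\<close> to \<open>z + n\<close> has
  length \<open>n\<close> and distance at least \<open>\<bar>Im z\<bar>\<close> from the origin. Products of \<open>m\<close> such points therefore
  lie in a sector of angle less than \<open>\<pi>\<close>, that is, in an open half-plane bounded by a line through
  the origin, and the nonempty sum of them that makes up the box polynomial cannot vanish.
\<close>

text \<open>Mean value theorem: the derivative of \<open>arctan\<close> lies between 0 and
  1.\<close>

lemma abs_arctan_diff_le: "\<bar>arctan x - arctan y\<bar> \<le> \<bar>x - y\<bar>"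
proof (induction x y rule: linorder_wlog)
  case (le x y)
  show ?case
  proof (cases "x = y")
    case False
    then obtain t where "arctan y - arctan x = (y - x) * inverse (1 + t\<^sup>2)"
      using MVT2[of x y arctan "\<lambda>t. inverse (1 + t\<^sup>2)"] DERIV_arctan le by auto
    moreover have "0 \<le> inverse (1 + t\<^sup>2)" "inverse (1 + t\<^sup>2) \<le> 1"
      by (auto simp: field_simps add_pos_nonneg)
    ultimately show ?thesis
      using mult_left_mono[of "inverse (1 + t\<^sup>2)" 1 "\<bar>y - x\<bar>"]
      by (metis abs_minus_commute abs_mult abs_of_nonneg mult.right_neutral abs_ge_zero)
  qed simp
next
  case (sym x y)
  then show ?case by (simp add: abs_minus_commute)
qed

text \<open>Polar form with the angle measured from the imaginary axis: \<open>z\<close> is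
  \<open>\<i> * Im z\<close> times \<open>1 - \<i> * u\<close>, where
  \<open>u = Re z / Im z\<close>. The first factor carries the sign of \<open>Im z\<close>, so both
  half-planes are covered at once.\<close>

lemma complex_eq_cis_arctan:
  assumes "Im z \<noteq> 0"
  shows "z = \<i> * of_real (Im z) *
    (of_real (sqrt (1 + (Re z / Im z)\<^sup>2)) * cis (- arctan (Re z / Im z)))"
proof -
  have "sqrt (1 + u\<^sup>2) \<noteq> 0" for u :: real
    using add_pos_nonneg[OF zero_less_one zero_le_power2, of u] by simp
  then show ?thesis
    using assms by (simp add: complex_eq_iff cos_arctan sin_arctan)
qed

lemma prod_of_real_mult_cis:
  "(\<Prod>i\<in>A. w * (of_real (r i) * cis (\<phi> i))) =
    w ^ card A * (of_real (\<Prod>i\<in>A. r i) * cis (\<Sum>i\<in>A. \<phi> i))"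
  by (induction A rule: infinite_finite_induct) (auto simp: cis_mult[symmetric])

lemma box_partitions_nth_le: "l \<in> box_partitions m n \<Longrightarrow> i < m \<Longrightarrow> l ! i \<le> n"
  by (auto simp: box_partitions_def)

lemma box_partitions_nonempty: "box_partitions m n \<noteq> {}"
proof -
  have "replicate m 0 \<in> box_partitions m n"
    by (auto simp: box_partitions_def sorted_wrt_iff_nth_less)
  then show ?thesis by blast
qed

lemma poly_box_poly_nonzero:
  fixes z :: complex
  assumes "real m * real n < pi * \<bar>Im z\<bar>"
  shows "poly (box_poly m n) z \<noteq> 0"
proof -
  have T: "Im z \<noteq> 0"
    using assms by (auto simp: mult_less_0_iff not_less)
  define u where "u k = (Re z + real k) / Im z" for k
  \<comment> \<open>\<open>w\<close> is a positive multiple of the midpoint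
    \<open>z + n / 2\<close>. Measured from there, the angle \<open>\<phi> k\<close> is at most half
    the opening of the sector.\<close>
  define c where "c = arctan ((Re z + real n / 2) / Im z)"
  define w where "w = \<i> * of_real (Im z) * cis (- c)"
  define r where "r k = sqrt (1 + (u k)\<^sup>2)" for k
  define \<phi> where "\<phi> k = c - arctan (u k)" for k
  define R where "R l = (\<Prod>i<m. r (l ! i))" for l
  define \<Phi> where "\<Phi> l = (\<Sum>i<m. \<phi> (l ! i))" for l
  have factor: "z + of_nat k = w * (of_real (r k) * cis (\<phi> k))" for k
    using complex_eq_cis_arctan[of "z + of_nat k"] T
      cis_mult[of "- c" "\<phi> k"]
    by (simp add: w_def r_def \<phi>_def u_def mult_ac)
  have rpos: "0 < r k" for k
    by (simp add: r_def add_pos_nonneg)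
  have \<phi>_bound: "\<bar>\<phi> k\<bar> \<le> real n / 2 / \<bar>Im z\<bar>" if "k \<le> n" for k
  proof -
    have "\<bar>\<phi> k\<bar> \<le> \<bar>(Re z + real n / 2) / Im z - u k\<bar>"
      unfolding \<phi>_def c_def by (rule abs_arctan_diff_le)
    also have "\<dots> = \<bar>real n / 2 - real k\<bar> / \<bar>Im z\<bar>"
      by (simp add: u_def abs_divide flip: diff_divide_distrib)
    also have "\<dots> \<le> real n / 2 / \<bar>Im z\<bar>"
      using that by (intro divide_right_mono) linarith+
    finally show ?thesis .
  qed
  have pos: "0 < R l * cos (\<Phi> l)" if l: "l \<in> box_partitions m n" for l
  proof -
    have "\<bar>\<Phi> l\<bar> \<le> (\<Sum>i<m. \<bar>\<phi> (l ! i)\<bar>)"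
      unfolding \<Phi>_def by (rule sum_abs)
    also have "\<dots> \<le> (\<Sum>i<m. real n / 2 / \<bar>Im z\<bar>)"
      using box_partitions_nth_le[OF l] by (intro sum_mono \<phi>_bound) auto
    \<comment> \<open>The sum is \<open>m * n / (2 * \<bar>Im z\<bar>)\<close>; this is where the
      bound on \<open>Im z\<close> enters.\<close>
    also have "\<dots> < pi / 2"
      using assms T by (simp add: field_simps)
    finally have "0 < cos (\<Phi> l)"
      by (intro cos_gt_zero_pi) auto
    moreover have "0 < R l"
      unfolding R_def by (intro prod_pos) (simp add: rpos)
    ultimately show ?thesis by simp
  qed
  have eq: "poly (box_poly m n) z =
      w ^ m * (\<Sum>l\<in>box_partitions m n. of_real (R l) * cis (\<Phi> l))"
    by (simp add: poly_box_poly factor prod_of_real_mult_cis R_def \<Phi>_def sum_distrib_left)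
  \<comment> \<open>With \<open>w ^ m\<close> factored out, the half-plane containing all summands
    is the right one.\<close>
  have "0 < Re (\<Sum>l\<in>box_partitions m n. of_real (R l) * cis (\<Phi> l))"
    using pos sum_pos[OF finite_box_partitions box_partitions_nonempty, of m n "\<lambda>l. R l * cos (\<Phi> l)"]
    by simp
  then have "(\<Sum>l\<in>box_partitions m n. of_real (R l) * cis (\<Phi> l)) \<noteq> 0"
    by (metis less_irrefl zero_complex.simps(1))
  moreover have "w \<noteq> 0"
    using T by (simp add: w_def)
  ultimately show ?thesis
    by (simp add: eq)
qed

theorem theorem7p6:
  fixes m n :: nat and z :: complex
  assumes "poly (box_poly m n) z = 0"
  shows "- (real m * real n / pi) \<le> Im z \<and> Im z \<le> real m * real n / pi"
proof -
  have "pi * \<bar>Im z\<bar> \<le> real m * real n"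
    using assms poly_box_poly_nonzero[of m n z] by (meson not_less)
  then have "\<bar>Im z\<bar> \<le> real m * real n / pi"
    by (simp add: pos_le_divide_eq mult.commute)
  then show ?thesis by (simp add: abs_le_iff)
qed

end
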